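(* Let $n\ge 2$ be either a power of $2$ or an odd prime, and let $P_n$ be the path on vertices $1,\ldots,n$ (consecutive labels adjacent). Then for every integer $1\le a\le n-1$, $P_n$ has Laplacian pretty good edge state transfer from $\{a,a+1\}$ to $\{n-a,n-a+1\}$.
   Context: For a graph $G$ with Laplacian $L_G=D_G-A_G$ and $U(t)=\exp(-\mathrm{i}tL_G)$, $G$ has Laplacian pretty good edge state transfer (Edge-LPGST) from the edge $\{a,b\}$ to the edge $\{c,d\}$ if for every $\epsilon>0$ there exist $\tau\in\mathbb{R}$ and $\gamma\in\mathbb{C}$ with $|\gamma|=1$ such that $\left|U(\tau)(\mathbf{e}_a-\mathbf{e}_b)-\gamma(\mathbf{e}_c-\mathbf{e}_d)\right|<\epsilon$, where $\mathbf{e}_u$ is the standard unit vector at vertex $u$. *)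

theory Defs
  imports
    "Jordan_Normal_Form.Matrix"
    "HOL-Analysis.L2_Norm"
    "HOL-Computational_Algebra.Primes"
begin

(* Graphs have vertex set {1..n} and are given by their edge set.  Matrix and vector indices
   of Jordan_Normal_Form start at 0, so vertex v corresponds to index v - 1. *)

definition simple_graph :: "nat \<Rightarrow> nat set set \<Rightarrow> bool" where
  "simple_graph n E \<longleftrightarrow> (\<forall>e\<in>E. \<exists>u v. e = {u, v} \<and> u \<in> {1..n} \<and> v \<in> {1..n} \<and> u \<noteq> v)"

definition vertex_degree :: "nat \<Rightarrow> nat set set \<Rightarrow> nat \<Rightarrow> nat" where
  "vertex_degree n E u = card {v \<in> {1..n}. {u, v} \<in> E}"

definition adjacency_mat :: "nat \<Rightarrow> nat set set \<Rightarrow> complex mat" where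
  "adjacency_mat n E = mat n n (\<lambda>(i, j). if {Suc i, Suc j} \<in> E then 1 else 0)"

definition degree_mat :: "nat \<Rightarrow> nat set set \<Rightarrow> complex mat" where
  "degree_mat n E = mat_diag n (\<lambda>i. of_nat (vertex_degree n E (Suc i)))"

definition laplacian_mat :: "nat \<Rightarrow> nat set set \<Rightarrow> complex mat" where
  "laplacian_mat n E = degree_mat n E - adjacency_mat n E"

(* The power series of exp, summed entrywise; it always converges, see summable_mat_exp. *)
definition mat_exp :: "complex mat \<Rightarrow> complex mat" where
  "mat_exp A = mat (dim_row A) (dim_row A) (\<lambda>(i, j). \<Sum>k. (A ^\<^sub>m k) $$ (i, j) / fact k)"

definition transition_mat :: "nat \<Rightarrow> nat set set \<Rightarrow> real \<Rightarrow> complex mat" where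
  "transition_mat n E t = mat_exp ((- \<i> * of_real t) \<cdot>\<^sub>m laplacian_mat n E)"

definition vertex_vec :: "nat \<Rightarrow> nat \<Rightarrow> complex vec" where
  "vertex_vec n u = unit_vec n (u - 1)"

definition l2_norm_vec :: "complex vec \<Rightarrow> real" where
  "l2_norm_vec v = L2_set (\<lambda>i. cmod (v $ i)) {0..<dim_vec v}"

(* The edges are {a, b} and {c, d}.  Exchanging a and b (or c and d) only changes the sign
   of a vector, which is absorbed by the phase g, so the property does not depend on how the
   edges are oriented. *)
definition edge_LPGST :: "nat \<Rightarrow> nat set set \<Rightarrow> nat \<Rightarrow> nat \<Rightarrow> nat \<Rightarrow> nat \<Rightarrow> bool" where
  "edge_LPGST n E a b c d \<longleftrightarrow>
     simple_graph n E \<and> {a, b} \<in> E \<and> {c, d} \<in> E \<and>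
     (\<forall>\<epsilon>>0. \<exists>(\<tau>::real) (g::complex). cmod g = 1 \<and>
        l2_norm_vec (transition_mat n E \<tau> *\<^sub>v (vertex_vec n a - vertex_vec n b)
                     - g \<cdot>\<^sub>v (vertex_vec n c - vertex_vec n d)) < \<epsilon>)"

definition path_edges :: "nat \<Rightarrow> nat set set" where
  "path_edges n = {{i, i + 1} | i. 1 \<le> i \<and> i + 1 \<le> n}"

lemma norm_pow_mat_entry_le:
  fixes A :: "complex mat"
  assumes A: "A \<in> carrier_mat n n" and c: "\<And>i j. i < n \<Longrightarrow> j < n \<Longrightarrow> cmod (A $$ (i, j)) \<le> c"
    and ij: "i < n" "j < n"
  shows "cmod ((A ^\<^sub>m k) $$ (i, j)) \<le> (real n * c) ^ k"
  using ij
proof (induction k arbitrary: i j)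
  case 0
  then show ?case using A by (auto simp: one_mat_def)
next
  case (Suc k)
  have P: "A ^\<^sub>m k \<in> carrier_mat n n" using A by simp
  have c0: "0 \<le> c" using c[OF Suc.prems] norm_ge_zero order_trans by blast
  have "(A ^\<^sub>m Suc k) $$ (i, j) = (\<Sum>l = 0..<n. (A ^\<^sub>m k) $$ (i, l) * A $$ (l, j))"
    using A P Suc.prems by (simp add: scalar_prod_def)
  also have "cmod \<dots> \<le> (\<Sum>l = 0..<n. cmod ((A ^\<^sub>m k) $$ (i, l)) * cmod (A $$ (l, j)))"
    by (rule order_trans[OF norm_sum]) (simp add: norm_mult)
  also have "\<dots> \<le> (\<Sum>l = 0..<n. (real n * c) ^ k * c)"
    using Suc c c0 by (intro sum_mono mult_mono) auto
  also have "\<dots> = (real n * c) ^ Suc k" by simp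
  finally show ?case .
qed

lemma summable_mat_exp:
  fixes A :: "complex mat"
  assumes A: "A \<in> carrier_mat n n" and ij: "i < n" "j < n"
  shows "summable (\<lambda>k. (A ^\<^sub>m k) $$ (i, j) / fact k)"
proof -
  define c where "c = Max ((\<lambda>(i, j). cmod (A $$ (i, j))) ` ({..<n} \<times> {..<n}))"
  have c: "cmod (A $$ (i, j)) \<le> c" if "i < n" "j < n" for i j
    unfolding c_def using that by (intro Max_ge) auto
  have "summable (\<lambda>k. (real n * c) ^ k / fact k)"
    using summable_exp[of "real n * c"] by (simp add: divide_inverse mult.commute)
  then show ?thesis
  proof (rule summable_comparison_test')
    fix k :: nat
    show "norm ((A ^\<^sub>m k) $$ (i, j) / fact k) \<le> (real n * c) ^ k / fact k"
      using norm_pow_mat_entry_le[OF A c ij, of k]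
      by (simp add: norm_divide divide_right_mono)
  qed
qed

end

theory Submission
  imports
    Defs
    "Jordan_Normal_Form.Char_Poly"
    "HOL-Analysis.Kronecker_Approximation_Theorem"
begin

text \<open>
  The Laplacian eigenvalues of the path are $2 - 2\cos(\pi j/n)$ for $0 \le j < n$, and the reflection
  of the path acts on the $j$-th eigenvector by $(-1)^j$. The difference of two adjacent unit vectors is
  orthogonal to the constant eigenvector $j = 0$, so it suffices to find $t$ and a phase $\gamma$ with
  $e^{2 i t \cos(\pi j/n)} \approx \gamma (-1)^j$ for $0 < j < n$. Since $\cos(\pi (n-j)/n) = -\cos(\pi j/n)$,
  only half of these conditions have to be met: take $\gamma = 1$ and $0 < j < n/2$ if $n \ge 4$ is a power
  of two, and $\gamma = i$ and $j$ even if $n$ is an odd prime. The cosines that remain are linearly independent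
  over the integers, because the cyclotomic polynomial of order $2n$ or $n$, respectively, is irreducible by
  Eisenstein's criterion, and Kronecker's theorem yields $t$.
\<close>

unbundle no vec_syntax

section \<open>Roots of cyclotomic polynomials\<close>

text \<open>Take the least \<open>i\<close> with \<open>coeff g i\<close> not divisible by
  \<open>p\<close>. Modulo \<open>p\<close>, the coefficient of \<open>f * g\<close> at
  \<open>i\<close> is \<open>coeff f 0 * coeff g i\<close>, hence nonzero. So \<open>i\<close> is at
  least the degree of the product but at most that of \<open>g\<close>, which leaves degree 0 for
  \<open>f\<close>.\<close>

lemma eisenstein_factor_degree:
  fixes f g :: "'a :: idom poly"
  assumes p: "prime_elem p" and lc: "lead_coeff (f * g) = 1"
    and dvd: "\<And>i. i < degree (f * g) \<Longrightarrow> p dvd coeff (f * g) i" and f0: "\<not> p dvd coeff f 0"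
  shows "degree f = 0"
proof -
  have lc': "lead_coeff f * lead_coeff g = 1" using lc by (simp add: lead_coeff_mult)
  then have nz: "f \<noteq> 0" "g \<noteq> 0" by auto
  \<comment> \<open>The leading coefficient of \<open>g\<close> is a unit, so an index as required
    for \<open>i\<close> exists.\<close>
  have "\<not> p dvd lead_coeff g"
    using lc' p by (metis dvd_mult dvd_trans prime_elem_not_unit)
  define i where "i = (LEAST i. \<not> p dvd coeff g i)"
  have i: "\<not> p dvd coeff g i" "i \<le> degree g"
    unfolding i_def using \<open>\<not> p dvd lead_coeff g\<close>
    by (rule LeastI[of "\<lambda>i. \<not> p dvd coeff g i"], rule Least_le)
  have less: "p dvd coeff g j" if "j < i" for j
    using not_less_Least that unfolding i_def by blast
  have "coeff (f * g) i = (\<Sum>j\<le>i. coeff f j * coeff g (i - j))"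
    by (simp add: coeff_mult)
  also have "\<dots> = coeff f 0 * coeff g i + (\<Sum>j\<in>{..i} - {0}. coeff f j * coeff g (i - j))"
    by (subst sum.remove[of _ 0]) auto
  finally have eq: "coeff (f * g) i = \<dots>" .
  have "p dvd (\<Sum>j\<in>{..i} - {0}. coeff f j * coeff g (i - j))"
    by (intro dvd_sum dvd_mult less) auto
  moreover have "\<not> p dvd coeff f 0 * coeff g i"
    using p f0 i(1) prime_elem_dvd_mult_iff by blast
  ultimately have "\<not> p dvd coeff (f * g) i"
    unfolding eq using dvd_add_left_iff by blast
  then have "degree (f * g) \<le> i" using dvd not_less by blast
  then show ?thesis using i(2) nz by (simp add: degree_mult_eq)
qed

text \<open>Eisenstein's criterion in the monic case. If \<open>p\<close> divided both constant
  terms of a factorization, \<open>p^2\<close> would divide that of \<open>F\<close>; so the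
  previous lemma makes one factor constant, and monicity makes this constant a unit.\<close>

lemma eisenstein_irreducible:
  fixes F :: "'a :: idom poly"
  assumes p: "prime_elem p" and lc: "lead_coeff F = 1" and deg: "degree F > 0"
    and dvd: "\<And>i. i < degree F \<Longrightarrow> p dvd coeff F i" and sq: "\<not> p\<^sup>2 dvd coeff F 0"
  shows "irreducible F"
proof (rule irreducibleI)
  show "F \<noteq> 0" "\<not> F dvd 1" using deg by (auto simp: is_unit_poly_iff)
  fix f g assume F: "F = f * g"
  have unit: "f dvd 1" if "f * g = F" "degree f = 0" for f g
  proof -
    obtain c where c: "f = [:c:]" using \<open>degree f = 0\<close> by (metis degree_eq_zeroE)
    have "c * lead_coeff g = 1" using lc that(1) c by (metis lead_coeff_mult lead_coeff_pCons(2))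
    then show ?thesis unfolding c by (metis dvd_triv_left is_unit_const_poly_iff)
  qed
  have "\<not> (p dvd coeff f 0 \<and> p dvd coeff g 0)"
    using sq unfolding F by (auto simp: coeff_mult power2_eq_square intro: mult_dvd_mono)
  then show "f dvd 1 \<or> g dvd 1"
  proof (elim de_Morgan_conj[THEN iffD1, THEN disjE])
    assume "\<not> p dvd coeff f 0"
    then show ?thesis
      using eisenstein_factor_degree[OF p, of f g] lc dvd unit unfolding F by blast
  next
    assume "\<not> p dvd coeff g 0"
    then show ?thesis
      using eisenstein_factor_degree[OF p, of g f] lc dvd unit unfolding F
      by (metis mult.commute)
  qed
qed

text \<open>A nonzero integer polynomial \<open>h\<close> of least degree vanishing at
  \<open>w\<close> stands in for the minimal polynomial. If \<open>F\<close> had larger degree,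
  pseudo-division by \<open>h\<close> would give \<open>c * F = h * q\<close>; the prime element
  \<open>F\<close> then divides \<open>q\<close>, and cancelling it makes \<open>h\<close> a nonzero
  constant, which has no root.\<close>

lemma irreducible_root_degree_le:
  fixes F f :: "int poly" and w :: "'a :: field_char_0"
  assumes irr: "irreducible F" and root: "poly (of_int_poly F) w = 0"
    and f: "f \<noteq> 0" "poly (of_int_poly f) w = 0"
  shows "degree F \<le> degree f"
proof (rule ccontr)
  assume "\<not> degree F \<le> degree f"
  define P where "P = (\<lambda>h :: int poly. h \<noteq> 0 \<and> poly (of_int_poly h) w = 0)"
  define h where "h = (ARG_MIN degree h. P h)"
  have "P f" using f by (simp add: P_def)
  then have h: "P h" unfolding h_def by (rule arg_min_natI)
  have min: "degree h \<le> degree h'" if "P h'" for h'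
    unfolding h_def using that by (rule arg_min_nat_le)
  have deg: "degree h < degree F" using min[of f] f \<open>\<not> degree F \<le> degree f\<close> by (simp add: P_def)
  \<comment> \<open>Pseudo-division keeps quotient and remainder integral at the price of the factor
    \<open>c\<close>, a power of the leading coefficient of \<open>h\<close>.\<close>
  obtain q r where qr: "pseudo_divmod F h = (q, r)" by force
  define c where "c = lead_coeff h ^ (Suc (degree F) - degree h)"
  have h0: "h \<noteq> 0" using h by (simp add: P_def)
  have eq: "smult c F = h * q + r" and r: "r = 0 \<or> degree r < degree h"
    using pseudo_divmod[OF h0 qr] by (simp_all add: c_def)
  have "c \<noteq> 0" using h0 by (simp add: c_def)
  have "poly (of_int_poly (smult c F)) w = poly (of_int_poly (h * q + r)) w" by (simp add: eq)
  then have "poly (of_int_poly r) w = 0" using h root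
    by (simp add: P_def of_int_hom.map_poly_hom_smult of_int_poly_hom.hom_add of_int_poly_hom.hom_mult)
  then have "r = 0" using r min[of r] by (metis P_def not_less)
  have "prime_elem F" using irr by (rule irreducible_imp_prime_elem)
  moreover have "F dvd h * q" using eq \<open>r = 0\<close> by (metis add_0_right dvd_refl dvd_smult)
  moreover have "\<not> F dvd h" using deg h0 by (meson dvd_imp_degree_le not_less)
  ultimately obtain k where k: "q = F * k" by (meson prime_elem_dvd_mult_iff dvdE)
  have "F \<noteq> 0" using irr by auto
  have "F * [:c:] = F * (h * k)" using eq \<open>r = 0\<close> k by (simp add: mult_ac)
  then have "[:c:] = h * k" using \<open>F \<noteq> 0\<close> by (metis mult_cancel_left)
  then have "degree h = 0" using \<open>c \<noteq> 0\<close>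
    by (metis degree_mult_eq_0 degree_pCons_0 mult_eq_0_iff pCons_eq_0_iff)
  then obtain d where "h = [:d:]" by (metis degree_eq_zeroE)
  then show False using h by (auto simp: P_def map_poly_pCons)
qed

text \<open>Cyclotomic polynomials become Eisenstein polynomials only after this shift of the variable.\<close>

lemma root_degree_le_shift:
  fixes F f :: "int poly" and w :: "'a :: field_char_0"
  assumes irr: "irreducible F" and root: "poly (of_int_poly F) (w - 1) = 0"
    and f: "f \<noteq> 0" "poly (of_int_poly f) w = 0"
  shows "degree F \<le> degree f"
proof -
  have "poly (of_int_poly (f \<circ>\<^sub>p [:1, 1:])) (w - 1) = 0"
    using f(2) by (simp add: of_int_hom.map_poly_pcompose poly_pcompose)
  moreover have "f \<circ>\<^sub>p [:1, 1:] \<noteq> 0" using f(1) by (simp add: pcompose_eq_0_iff)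
  ultimately have "degree F \<le> degree (f \<circ>\<^sub>p [:1, 1:])"
    by (intro irreducible_root_degree_le[OF irr root])
  then show ?thesis by (simp add: degree_pcompose)
qed

text \<open>Here \<open>w\<close> is a primitive root of unity of order \<open>2^(k+1)\<close>, and
  \<open>F\<close> is its cyclotomic polynomial \<open>X^(2^k) + 1\<close> shifted to
  \<open>X + 1\<close>. It is Eisenstein at 2, with constant term 2.\<close>

lemma two_power_root_degree_le:
  fixes f :: "int poly" and w :: "'a :: field_char_0"
  assumes w: "w ^ 2 ^ k = - 1" and f: "f \<noteq> 0" "poly (of_int_poly f) w = 0"
  shows "2 ^ k \<le> degree f"
proof -
  define F :: "int poly" where "F = [:1, 1:] ^ 2 ^ k + 1"
  \<comment> \<open>Modulo 2, \<open>(X + 1)^(2^k) = X^(2^k) + 1\<close>, by repeated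
    squaring.\<close>
  have ex: "\<exists>q. [:1, 1:] ^ 2 ^ k = monom 1 (2 ^ k) + 1 + 2 * (q :: int poly)" for k
  proof (induction k)
    case 0
    show ?case by (rule exI[of _ 0]) (simp add: monom_altdef one_pCons)
  next
    case (Suc k)
    then obtain q :: "int poly" where q: "[:1, 1:] ^ 2 ^ k = monom 1 (2 ^ k) + 1 + 2 * q" by blast
    have "[:1, 1:] ^ 2 ^ Suc k = ([:1, 1:] ^ 2 ^ k) ^ 2" by (simp add: power_mult[symmetric] mult.commute)
    also have "\<dots> = (monom 1 (2 ^ k)) ^ 2 + 1 + 2 * (2 * q\<^sup>2 + monom 1 (2 ^ k) + 2 * q + 2 * q * monom 1 (2 ^ k))"
      unfolding q by (simp add: power2_eq_square algebra_simps)
    also have "(monom 1 (2 ^ k)) ^ 2 = monom (1::int) (2 ^ Suc k)"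
      by (simp add: monom_power mult.commute)
    finally show ?case by blast
  qed
  obtain q :: "int poly" where q: "F = monom 1 (2 ^ k) + 2 * (1 + q)"
    using ex[of k] by (auto simp: F_def)
  have deg1: "degree ([:1, 1:] ^ 2 ^ k :: int poly) = 2 ^ k" by (simp add: degree_power_eq)
  have degF: "degree F = 2 ^ k" unfolding F_def by (subst degree_add_eq_left) (simp_all add: deg1)
  have coeff0: "coeff F 0 = 2" by (simp add: F_def coeff_0_power)
  have "lead_coeff ([:1, 1:] ^ 2 ^ k :: int poly) = 1" by (simp add: lead_coeff_power)
  then have lcF: "lead_coeff F = 1" unfolding degF using deg1 by (simp add: F_def)
  have "irreducible F"
  proof (rule eisenstein_irreducible[of 2])
    show "prime_elem (2 :: int)" by (simp add: prime_imp_prime_elem)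
    show "2 dvd coeff F i" if "i < degree F" for i
      using that unfolding degF unfolding q
      by (simp add: coeff_mult numeral_poly)
  qed (use lcF degF coeff0 in auto)
  moreover have "poly (of_int_poly F) (w - 1) = 0"
    using w by (simp add: F_def of_int_poly_hom.hom_add of_int_poly_hom.hom_power)
  ultimately show ?thesis using root_degree_le_shift[of F w f] f degF by simp
qed

text \<open>\<open>F\<close> is \<open>((X + 1)^p - 1) / X\<close>, the cyclotomic polynomial of
  order \<open>p\<close> after the shift. Its coefficients below the leading one are binomials
  divisible by \<open>p\<close>, and its constant term is \<open>p\<close> itself.\<close>

lemma prime_root_degree_le:
  fixes f :: "int poly" and w :: "'a :: field_char_0"
  assumes p: "prime p" and w: "w ^ p = 1" "w \<noteq> 1" and f: "f \<noteq> 0" "poly (of_int_poly f) w = 0"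
  shows "p - 1 \<le> degree f"
proof -
  define F :: "int poly" where "F = (\<Sum>i<p. monom (int (p choose Suc i)) i)"
  have p2: "p \<ge> 2" using p by (rule prime_ge_2_nat)
  have coeffF: "coeff F i = (if i < p then int (p choose Suc i) else 0)" for i
    by (simp add: F_def coeff_sum)
  have degF: "degree F = p - 1"
  proof (rule antisym)
    show "degree F \<le> p - 1" using p2 by (intro degree_le) (auto simp: coeffF)
    show "p - 1 \<le> degree F" using p2 by (intro le_degree) (auto simp: coeffF)
  qed
  have "irreducible F"
  proof (rule eisenstein_irreducible[of "int p"])
    show "prime_elem (int p)" using p by (simp add: prime_imp_prime_elem)
    show "lead_coeff F = 1" using p2 by (simp add: degF coeffF)
    show "int p dvd coeff F i" if "i < degree F" for i
      using that p dvd_choose_prime[of "Suc i" p] by (auto simp: degF coeffF)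
    show "\<not> (int p)\<^sup>2 dvd coeff F 0"
      using p2 by (auto simp: coeffF power2_eq_square)
  qed (use degF p2 in auto)
  moreover have "poly (of_int_poly F) (w - 1) = 0"
  proof -
    \<comment> \<open>The factor \<open>w - 1\<close> completes the sum to the binomial expansion of
      \<open>w^p\<close> without its constant term; it cancels because \<open>w\<close> is not
      1.\<close>
    have "(w - 1) * poly (of_int_poly F) (w - 1) = (\<Sum>i<p. of_nat (p choose Suc i) * (w - 1) ^ Suc i)"
      by (simp add: F_def of_int_poly_hom.hom_sum poly_sum poly_monom sum_distrib_left mult_ac)
    also have "\<dots> = (\<Sum>i\<le>p. of_nat (p choose i) * (w - 1) ^ i) - 1"
      by (subst lessThan_Suc_atMost[symmetric], subst sum.lessThan_Suc_shift) simp
    also have "(\<Sum>i\<le>p. of_nat (p choose i) * (w - 1) ^ i) = ((w - 1) + 1) ^ p"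
      by (subst binomial_ring) simp
    finally show ?thesis using w by simp
  qed
  ultimately show ?thesis using root_degree_le_shift[of F w f] f degF by simp
qed

section \<open>Kronecker approximation for cosines\<close>

text \<open>Adapts \<open>Kronecker_thm_1\<close>, which asks for an injective family whose set of
  values is independent over the integers. Both follow from the indexed hypothesis: two equal values
  would give a relation with coefficients 1 and -1.\<close>

lemma Kronecker_simult_int_independent:
  fixes \<theta> \<alpha> :: "nat \<Rightarrow> real"
  assumes indep: "\<And>c :: nat \<Rightarrow> int. (\<Sum>i<n. of_int (c i) * \<theta> i) = 0 \<Longrightarrow> (\<forall>i<n. c i = 0)"
    and "\<epsilon> > 0"
  obtains t h where "\<And>i. i < n \<Longrightarrow> \<bar>t * \<theta> i - of_int (h i) - \<alpha> i\<bar> < \<epsilon>"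
proof -
  interpret Modules.module "\<lambda>r. (*) (real_of_int r)"
    by (simp add: Modules.module.intro distrib_left mult.commute)
  have inj: "inj_on \<theta> {..<n}"
  proof (rule inj_onI, rule ccontr)
    fix i j assume ij: "i \<in> {..<n}" "j \<in> {..<n}" "\<theta> i = \<theta> j" "i \<noteq> j"
    define c where "c = (\<lambda>k. of_bool (k = i) - of_bool (k = j) :: int)"
    have "(\<Sum>k<n. of_int (c k) * \<theta> k) = (\<Sum>k<n. of_bool (k = i) * \<theta> k) - (\<Sum>k<n. of_bool (k = j) * \<theta> k)"
      by (simp add: c_def left_diff_distrib sum_subtractf)
    also have "\<dots> = 0" using ij by simp
    finally have "c i = 0" using indep ij(1) by blast
    then show False using ij(4) by (simp add: c_def)
  qed
  have "independent (\<theta> ` {..<n})"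
  proof
    assume "dependent (\<theta> ` {..<n})"
    then obtain u where u: "\<exists>v\<in>\<theta> ` {..<n}. u v \<noteq> 0" "(\<Sum>v\<in>\<theta> ` {..<n}. of_int (u v) * v) = 0"
      by (auto simp: dependent_finite)
    then have "(\<Sum>i<n. of_int (u (\<theta> i)) * \<theta> i) = 0" by (simp add: sum.reindex[OF inj])
    then have "\<forall>i<n. u (\<theta> i) = 0" using indep[of "\<lambda>i. u (\<theta> i)"] by simp
    then show False using u(1) by auto
  qed
  then show ?thesis using Kronecker_thm_1[OF _ inj \<open>\<epsilon> > 0\<close>] that by blast
qed

lemma norm_exp_i_diff_le: "cmod (exp (\<i> * of_real x) - exp (\<i> * of_real y)) \<le> \<bar>x - y\<bar>"
proof -
  have "exp (\<i> * of_real x) - exp (\<i> * of_real y) = exp (\<i> * of_real y) * (exp (\<i> * of_real (x - y)) - 1)"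
    by (simp add: right_diff_distrib exp_add[symmetric])
  then have "cmod (exp (\<i> * of_real x) - exp (\<i> * of_real y)) = 2 * \<bar>sin ((x - y) / 2)\<bar>"
    by (simp only: norm_mult norm_exp_i_times dist_exp_i_1)
  also have "\<dots> \<le> \<bar>x - y\<bar>" using abs_sin_x_le_abs_x[of "(x - y) / 2"] by simp
  finally show ?thesis .
qed

text \<open>Dividing angles by \<open>2 * pi\<close> turns approximation modulo 1 into approximation
  of phases: the integers \<open>h i\<close> become full turns, and a chord is no longer than its
  arc.\<close>

lemma Kronecker_exp:
  fixes \<theta> \<beta> :: "nat \<Rightarrow> real"
  assumes indep: "\<And>c :: nat \<Rightarrow> int. (\<Sum>i<n. of_int (c i) * \<theta> i) = 0 \<Longrightarrow> (\<forall>i<n. c i = 0)"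
    and "\<epsilon> > 0"
  obtains t where "\<And>i. i < n \<Longrightarrow> cmod (exp (\<i> * of_real (t * \<theta> i)) - exp (\<i> * of_real (\<beta> i))) < \<epsilon>"
proof -
  have "\<epsilon> / (2 * pi) > 0" using \<open>\<epsilon> > 0\<close> by simp
  from Kronecker_simult_int_independent[OF indep this, where \<alpha> = "\<lambda>i. \<beta> i / (2 * pi)"]
  obtain s h where sh: "\<And>i. i < n \<Longrightarrow> \<bar>s * \<theta> i - of_int (h i) - \<beta> i / (2 * pi)\<bar> < \<epsilon> / (2 * pi)"
    by blast
  have "cmod (exp (\<i> * of_real (2 * pi * s * \<theta> i)) - exp (\<i> * of_real (\<beta> i))) < \<epsilon>" if "i < n" for i
  proof -
    have "exp (\<i> * of_real (\<beta> i)) = exp (\<i> * of_real (\<beta> i + 2 * pi * of_int (h i)))"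
      unfolding exp_eq by (rule exI[of _ "- h i"]) (simp add: algebra_simps)
    then have "cmod (exp (\<i> * of_real (2 * pi * s * \<theta> i)) - exp (\<i> * of_real (\<beta> i)))
        \<le> \<bar>2 * pi * s * \<theta> i - (\<beta> i + 2 * pi * of_int (h i))\<bar>"
      by (simp only: norm_exp_i_diff_le)
    also have "2 * pi * s * \<theta> i - (\<beta> i + 2 * pi * of_int (h i))
        = 2 * pi * (s * \<theta> i - of_int (h i) - \<beta> i / (2 * pi))"
      by (simp add: field_simps)
    also have "\<bar>\<dots>\<bar> = 2 * pi * \<bar>s * \<theta> i - of_int (h i) - \<beta> i / (2 * pi)\<bar>" by (simp add: abs_mult)
    also have "\<dots> < \<epsilon>" using sh[OF that] by (simp add: field_simps)
    finally show ?thesis .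
  qed
  then show ?thesis using that by blast
qed

text \<open>With \<open>w = exp (i pi / n)\<close> and \<open>w^n = -1\<close>, twice the cosine is
  \<open>w^m - w^(n - m)\<close>. A relation thus becomes an integer polynomial of degree below
  \<open>n\<close> vanishing at \<open>w\<close>, which must be 0 by
  \<open>two_power_root_degree_le\<close>.\<close>

lemma cos_independent_two_power:
  fixes c :: "nat \<Rightarrow> int"
  assumes "(\<Sum>i<2 ^ k - 1. of_int (c i) * cos (pi * real (Suc i) / 2 ^ Suc k)) = 0" and "i < 2 ^ k - 1"
  shows "c i = 0"
proof -
  define n :: nat where "n = 2 ^ Suc k"
  define w where "w = exp (\<i> * of_real (pi / real n))"
  have n0: "n > 0" by (simp add: n_def)
  have pw: "w ^ m = exp (\<i> * of_real (pi * real m / real n))" for m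
    by (simp add: w_def exp_of_nat_mult[symmetric] mult_ac)
  have wn: "w ^ n = - 1" using n0 by (simp add: pw)
  have wcos: "w ^ m - w ^ (n - m) = of_real (2 * cos (pi * real m / real n))" if "m \<le> n" for m
  proof -
    have "w ^ (n - m) = exp (\<i> * of_real (pi - pi * real m / real n))"
      unfolding pw using that n0 by (simp add: of_nat_diff field_simps)
    also have "\<dots> = - exp (- (\<i> * of_real (pi * real m / real n)))"
      by (simp add: right_diff_distrib exp_diff exp_minus inverse_eq_divide)
    finally show ?thesis unfolding pw
      by (simp add: cos_exp_eq cos_of_real[symmetric])
  qed
  define f :: "int poly" where "f = (\<Sum>i<2 ^ k - 1. smult (c i) (monom 1 (Suc i) - monom 1 (n - Suc i)))"
  have "poly (of_int_poly f) w = (\<Sum>i<2 ^ k - 1. of_int (c i) * (w ^ Suc i - w ^ (n - Suc i)))"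
    by (simp add: f_def of_int_poly_hom.hom_sum of_int_hom.map_poly_hom_smult
        of_int_poly_hom.hom_minus poly_sum poly_monom)
  also have "\<dots> = (\<Sum>i<2 ^ k - 1. of_int (c i) * of_real (2 * cos (pi * real (Suc i) / real n)))"
    by (intro sum.cong refl, subst wcos) (auto simp: n_def)
  also have "\<dots> = of_real (2 * (\<Sum>i<2 ^ k - 1. of_int (c i) * cos (pi * real (Suc i) / 2 ^ Suc k)))"
    by (simp add: n_def sum_distrib_left mult_ac)
  finally have "poly (of_int_poly f) w = 0" unfolding assms(1) by simp
  moreover have "degree f < n"
    unfolding f_def using n0
    by (intro degree_sum_less degree_smult_le[THEN le_less_trans] degree_diff_less)
      (auto simp: degree_monom_eq n_def)
  ultimately have "f = 0"
    using two_power_root_degree_le[of w "Suc k" f] wn unfolding n_def by fastforce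
  have "coeff f (Suc i) = (\<Sum>j<2 ^ k - 1. if j = i then c j else 0)"
    unfolding f_def coeff_sum
  proof (intro sum.cong refl)
    fix j :: nat assume "j \<in> {..<2 ^ k - 1}"
    \<comment> \<open>The exponents \<open>Suc i\<close> lie below \<open>2^k\<close> and the
      exponents \<open>n - Suc j\<close> above it, so each coefficient of the relation can be read
      off from \<open>f\<close>.\<close>
    then have "n - Suc j \<noteq> Suc i" using assms(2) by (auto simp: n_def)
    then show "coeff (smult (c j) (monom 1 (Suc j) - monom 1 (n - Suc j))) (Suc i) = (if j = i then c j else 0)"
      by simp
  qed
  also have "\<dots> = c i" using assms(2) by simp
  finally show ?thesis using \<open>f = 0\<close> by simp
qed

text \<open>The same argument with a primitive \<open>p\<close>-th root of unity, where twice the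
  cosine is \<open>w^m + w^(p - m)\<close>.\<close>

lemma cos_independent_prime:
  fixes c :: "nat \<Rightarrow> int"
  assumes p: "prime p"
    and "(\<Sum>i<(p - 1) div 2. of_int (c i) * cos (2 * pi * real (Suc i) / real p)) = 0" and "i < (p - 1) div 2"
  shows "c i = 0"
proof -
  define N where "N = (p - 1) div 2"
  have N: "2 * N < p" using p prime_gt_0_nat[OF p] unfolding N_def by linarith
  define w where "w = exp (\<i> * of_real (2 * pi / real p))"
  have p2: "p \<ge> 2" using p by (rule prime_ge_2_nat)
  have pw: "w ^ m = exp (\<i> * of_real (2 * pi * real m / real p))" for m
    by (simp add: w_def exp_of_nat_mult[symmetric] mult_ac)
  have wp: "w ^ p = 1" using p2 by (simp add: pw exp_eq_1)
  have w1: "w \<noteq> 1"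
  proof
    assume "w = 1"
    then obtain m :: int where "2 * pi / real p = of_int (2 * m) * pi"
      by (auto simp: w_def exp_eq_1)
    then have "2 * pi * (1 / real p) = 2 * pi * of_int m" by simp
    then have "1 / real p = of_int m" unfolding mult_cancel_left by simp
    then have "1 = of_int m * real p" using p2 by (simp add: field_simps)
    then have "1 = m * int p" by (metis of_int_1 of_int_eq_iff of_int_mult of_int_of_nat_eq)
    then have "int p dvd 1" by (metis dvd_triv_right)
    then show False using p2 by simp
  qed
  have w0: "w \<noteq> 0" by (simp add: w_def)
  have wcos: "w ^ m + w ^ (p - m) = of_real (2 * cos (2 * pi * real m / real p))" if "m \<le> p" for m
  proof -
    have "w ^ (p - m) = inverse (w ^ m)" using wp w0 that by (simp add: power_diff inverse_eq_divide)
    then show ?thesis unfolding pw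
      by (simp add: cos_exp_eq cos_of_real[symmetric] exp_minus)
  qed
  \<comment> \<open>One factor \<open>w\<close> is divided out: the exponents \<open>Suc i\<close>
    and \<open>p - Suc i\<close> drop by one, which brings the degree down to at most
    \<open>p - 2\<close>, below the bound \<open>p - 1\<close>.\<close>
  define f :: "int poly" where "f = (\<Sum>i<N. smult (c i) (monom 1 i + monom 1 (p - 2 - i)))"
  have "w * poly (of_int_poly f) w = (\<Sum>i<N. of_int (c i) * (w ^ Suc i + w * w ^ (p - 2 - i)))"
    by (simp add: f_def of_int_poly_hom.hom_sum of_int_hom.map_poly_hom_smult
        of_int_poly_hom.hom_add poly_sum poly_monom sum_distrib_left algebra_simps)
  also have "\<dots> = (\<Sum>i<N. of_int (c i) * of_real (2 * cos (2 * pi * real (Suc i) / real p)))"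
  proof (intro sum.cong refl)
    fix i assume "i \<in> {..<N}"
    then have "w * w ^ (p - 2 - i) = w ^ (p - Suc i)" "Suc i \<le> p"
      using N by (auto simp: power_Suc[symmetric] Suc_diff_Suc simp del: power_Suc intro!: arg_cong[of _ _ "\<lambda>m. w ^ m"])
    then show "of_int (c i) * (w ^ Suc i + w * w ^ (p - 2 - i)) =
      of_int (c i) * complex_of_real (2 * cos (2 * pi * real (Suc i) / real p))"
      by (simp only: wcos)
  qed
  also have "\<dots> = of_real (2 * (\<Sum>i<N. of_int (c i) * cos (2 * pi * real (Suc i) / real p)))"
    by (simp add: sum_distrib_left mult_ac)
  also have "\<dots> = 0" unfolding N_def assms(2) by simp
  finally have "poly (of_int_poly f) w = 0" using w0 by simp
  moreover have "degree f < p - 1"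
    unfolding f_def using p2 N
    by (intro degree_sum_less degree_smult_le[THEN le_less_trans] degree_add_less)
      (auto simp: degree_monom_eq)
  ultimately have "f = 0"
    using prime_root_degree_le[OF p wp w1, of f] by fastforce
  have "coeff f i = (\<Sum>j<N. if j = i then c j else 0)"
    unfolding f_def coeff_sum
  proof (intro sum.cong refl)
    fix j :: nat assume "j \<in> {..<N}"
    then have "p - 2 - j \<noteq> i" using assms(3) N by (auto simp: N_def[symmetric])
    then show "coeff (smult (c j) (monom 1 j + monom 1 (p - 2 - j))) i = (if j = i then c j else 0)"
      by simp
  qed
  also have "\<dots> = c i" using assms(3) by (simp add: N_def)
  finally show ?thesis using \<open>f = 0\<close> by simp
qed

text \<open>The exponentials at \<open>j\<close> and \<open>n - j\<close> are complex conjugates, so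
  the targets must be too. This allows a real phase \<open>g\<close> for even \<open>n\<close> and
  \<open>g = i\<close> for odd \<open>n\<close>; half of the indices then determine the
  rest.\<close>

lemma exp_cos_approx_alternating:
  fixes n :: nat
  assumes n: "n \<ge> 2" "(\<exists>k. n = 2 ^ k) \<or> (prime n \<and> odd n)" and "\<epsilon> > 0"
  obtains t g where "cmod g = 1"
    "\<And>j. 0 < j \<Longrightarrow> j < n \<Longrightarrow> cmod (exp (\<i> * of_real (t * cos (pi * real j / real n))) - g * (- 1) ^ j) < \<epsilon>"
proof -
  have reflect: "cos (pi * real (n - j) / real n) = - cos (pi * real j / real n)" if "j \<le> n" for j
  proof -
    have "pi * real (n - j) / real n = pi - pi * real j / real n"
      using that n(1) by (simp add: of_nat_diff field_simps)
    then show ?thesis by simp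
  qed
  have conj: "cmod (exp (\<i> * of_real (t * cos (pi * real (n - j) / real n))) - cnj z)
      = cmod (exp (\<i> * of_real (t * cos (pi * real j / real n))) - z)" if "j \<le> n" for j t z
    unfolding reflect[OF that] mult_minus_right
    by (metis cis_cnj cis_conv_exp complex_cnj_diff complex_mod_cnj)
  \<comment> \<open>For a power of two, the middle index \<open>2^k\<close> has cosine 0 and
    exponential 1 at every time. This fits phase 1 only if \<open>2^k\<close> is even, so
    \<open>n = 2\<close> is split off.\<close>
  consider "n = 2" | k where "n = 2 ^ Suc k" "k > 0" | "prime n" "odd n"
  proof -
    assume *: "n = 2 \<Longrightarrow> thesis" "\<And>k. n = 2 ^ Suc k \<Longrightarrow> k > 0 \<Longrightarrow> thesis" "prime n \<Longrightarrow> odd n \<Longrightarrow> thesis"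
    show thesis using n(2)
    proof
      assume "\<exists>k. n = 2 ^ k"
      then obtain k where k: "n = 2 ^ k" by blast
      with n(1) obtain l where "k = Suc l" by (cases k) auto
      then show thesis using *(1) *(2)[of l] k by (cases "l = 0") auto
    qed (use * in blast)
  qed
  then show thesis
  proof cases
    case 1
    show thesis
    proof (rule that[of "- 1" 0])
      \<comment> \<open>The only index is 1, with cosine 0; the phase -1 makes its target 1.\<close>
      fix j :: nat assume "0 < j" "j < n"
      then have "j = 1" using 1 by simp
      then show "cmod (exp (\<i> * of_real (0 * cos (pi * real j / real n))) - - 1 * (- 1) ^ j) < \<epsilon>"
        using \<open>\<epsilon> > 0\<close> by simp
    qed simp
  next
    case (2 k)
    obtain t where t: "\<And>i. i < 2 ^ k - 1 \<Longrightarrow>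
        cmod (exp (\<i> * of_real (t * cos (pi * real (Suc i) / 2 ^ Suc k))) - exp (\<i> * of_real (pi * real (Suc i)))) < \<epsilon>"
      using Kronecker_exp[where n = "2 ^ k - 1" and \<theta> = "\<lambda>i. cos (pi * real (Suc i) / 2 ^ Suc k)"
          and \<beta> = "\<lambda>i. pi * real (Suc i)"]
        cos_independent_two_power \<open>\<epsilon> > 0\<close> by blast
    have low: "cmod (exp (\<i> * of_real (t * cos (pi * real j / real n))) - (- 1) ^ j) < \<epsilon>"
      if "0 < j" "j < 2 ^ k" for j
    proof -
      have "exp (\<i> * of_real (pi * real j)) = exp (\<i> * of_real pi) ^ j"
        by (subst exp_of_nat_mult[symmetric]) (simp add: mult_ac)
      then have "exp (\<i> * of_real (pi * real j)) = (- 1) ^ j" by simp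
      with t[of "j - 1"] that show ?thesis by (simp add: 2)
    qed
    show thesis
    proof (rule that[of 1 t])
      fix j :: nat assume j: "0 < j" "j < n"
      consider "j < 2 ^ k" | "j = 2 ^ k" | "j > 2 ^ k" by linarith
      then show "cmod (exp (\<i> * of_real (t * cos (pi * real j / real n))) - 1 * (- 1) ^ j) < \<epsilon>"
      proof cases
        case 1
        then show ?thesis using low j by simp
      next
        case 2
        then have "pi * real j / real n = pi / 2" using \<open>n = 2 ^ Suc k\<close> by (simp add: field_simps)
        then have "cos (pi * real j / real n) = 0" by (simp only: cos_pi_half)
        then show ?thesis using 2 \<open>k > 0\<close> \<open>\<epsilon> > 0\<close> by (simp only:) simp
      next
        case 3
        then have "cmod (exp (\<i> * of_real (t * cos (pi * real (n - j) / real n))) - (- 1) ^ (n - j)) < \<epsilon>"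
          using j \<open>n = 2 ^ Suc k\<close> by (intro low) auto
        moreover have "(- 1 :: complex) ^ (n - j) = cnj ((- 1) ^ j)"
          using j \<open>n = 2 ^ Suc k\<close> by (simp add: minus_one_power_iff)
        ultimately show ?thesis using conj[of j t "(- 1) ^ j"] j by (simp only:) simp
      qed
    qed simp
  next
    case 3
    obtain t where t: "\<And>i. i < (n - 1) div 2 \<Longrightarrow>
        cmod (exp (\<i> * of_real (t * cos (2 * pi * real (Suc i) / real n))) - exp (\<i> * of_real (pi / 2))) < \<epsilon>"
      using Kronecker_exp[where n = "(n - 1) div 2" and \<theta> = "\<lambda>i. cos (2 * pi * real (Suc i) / real n)"
          and \<beta> = "\<lambda>i. pi / 2"]
        cos_independent_prime[OF 3(1)] \<open>\<epsilon> > 0\<close> by blast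
    have ev: "cmod (exp (\<i> * of_real (t * cos (pi * real j / real n))) - \<i>) < \<epsilon>"
      if "0 < j" "j < n" "even j" for j
    proof -
      obtain m where m: "j = 2 * m" using \<open>even j\<close> by blast
      have "m - 1 < (n - 1) div 2" "m > 0" using that m by auto
      moreover have "exp (\<i> * of_real (pi / 2)) = \<i>" by (metis cis_conv_exp cis_pi_half)
      ultimately show ?thesis using t[of "m - 1"] by (simp add: m mult_ac)
    qed
    show thesis
    proof (rule that[of \<i> t])
      fix j :: nat assume j: "0 < j" "j < n"
      show "cmod (exp (\<i> * of_real (t * cos (pi * real j / real n))) - \<i> * (- 1) ^ j) < \<epsilon>"
      proof (cases "even j")
        case True
        then show ?thesis using ev j by simp
      next
        \<comment> \<open>For odd \<open>j\<close> the index \<open>n - j\<close> is even, and its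
          target \<open>i\<close> is the conjugate of \<open>-i\<close>, the target at
          \<open>j\<close>.\<close>
        case False
        then have "cmod (exp (\<i> * of_real (t * cos (pi * real (n - j) / real n))) - \<i>) < \<epsilon>"
          using j \<open>odd n\<close> by (intro ev) auto
        then show ?thesis using conj[of j t "- \<i>"] j False by (simp del: of_nat_diff)
      qed
    qed simp
  qed
qed

section \<open>Spectral decomposition of the path\<close>

lemma pow_mat_mult_eigenvector:
  fixes A :: "'a :: field mat"
  assumes A: "A \<in> carrier_mat n n" and v: "v \<in> carrier_vec n" and eq: "A *\<^sub>v v = e \<cdot>\<^sub>v v"
  shows "(A ^\<^sub>m k) *\<^sub>v v = e ^ k \<cdot>\<^sub>v v"
proof (induction k)
  case 0
  show ?case using A v by simp
next
  case (Suc k)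
  have "(A ^\<^sub>m Suc k) *\<^sub>v v = (A ^\<^sub>m k) *\<^sub>v (A *\<^sub>v v)"
    using A v by (simp add: assoc_mult_mat_vec[of _ n n])
  also have "\<dots> = e \<cdot>\<^sub>v ((A ^\<^sub>m k) *\<^sub>v v)"
    using A v by (simp add: eq mult_mat_vec[of _ n n])
  also have "\<dots> = e ^ Suc k \<cdot>\<^sub>v v" by (simp add: Suc smult_smult_assoc)
  finally show ?case .
qed

lemma mat_exp_mult_eigenvector:
  assumes A: "A \<in> carrier_mat n n" and v: "v \<in> carrier_vec n" and eq: "A *\<^sub>v v = e \<cdot>\<^sub>v v"
  shows "mat_exp A *\<^sub>v v = exp e \<cdot>\<^sub>v v"
proof (rule eq_vecI)
  fix i assume "i < dim_vec (exp e \<cdot>\<^sub>v v)"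
  then have i: "i < n" using v by simp
  have "(mat_exp A *\<^sub>v v) $ i = (\<Sum>j<n. (\<Sum>k. (A ^\<^sub>m k) $$ (i, j) / fact k) * v $ j)"
    using A v i by (simp add: mat_exp_def scalar_prod_def atLeast0LessThan)
  also have "\<dots> = (\<Sum>j<n. \<Sum>k. (A ^\<^sub>m k) $$ (i, j) / fact k * v $ j)"
    using summable_mat_exp[OF A i] by (intro sum.cong refl suminf_mult2) auto
  also have "\<dots> = (\<Sum>k. \<Sum>j<n. (A ^\<^sub>m k) $$ (i, j) / fact k * v $ j)"
    using summable_mat_exp[OF A i] by (intro suminf_sum[symmetric] summable_mult2) auto
  also have "\<dots> = (\<Sum>k. e ^ k /\<^sub>R fact k * v $ i)"
  proof (intro suminf_cong)
    fix k
    have "(\<Sum>j<n. (A ^\<^sub>m k) $$ (i, j) / fact k * v $ j) = ((A ^\<^sub>m k) *\<^sub>v v) $ i / fact k"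
      using A v i by (simp add: scalar_prod_def atLeast0LessThan sum_divide_distrib)
    also have "\<dots> = e ^ k /\<^sub>R fact k * v $ i"
      using pow_mat_mult_eigenvector[OF A v eq, of k] v i
      by (simp add: scaleR_conv_of_real field_simps)
    finally show "(\<Sum>j<n. (A ^\<^sub>m k) $$ (i, j) / fact k * v $ j) = e ^ k /\<^sub>R fact k * v $ i" .
  qed
  also have "\<dots> = exp e * v $ i"
    unfolding exp_def by (intro suminf_mult2[symmetric] summable_exp_generic)
  finally show "(mat_exp A *\<^sub>v v) $ i = (exp e \<cdot>\<^sub>v v) $ i" using v i by simp
qed (use A v in \<open>simp add: mat_exp_def\<close>)

text \<open>Index \<open>k\<close> belongs to vertex \<open>k + 1\<close>; the offset \<open>1/2\<close> makes the cosine symmetric about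
  the midpoints between the vertices 0, 1 and \<open>n\<close>, \<open>n + 1\<close>, so that the end vertices of the path
  satisfy the same recurrence as the inner ones.\<close>

definition path_eigenvec :: "nat \<Rightarrow> nat \<Rightarrow> complex Matrix.vec" where
  "path_eigenvec n j = Matrix.vec n (\<lambda>k. of_real (cos (pi * real j * (real k + 1 / 2) / real n)))"

lemma path_eigenvec_carrier [simp]: "path_eigenvec n j \<in> carrier_vec n"
  by (simp add: path_eigenvec_def)

lemma path_eigenvec_index:
  "k < n \<Longrightarrow> path_eigenvec n j $ k = of_real (cos (pi * real j * (real k + 1 / 2) / real n))"
  by (simp add: path_eigenvec_def)

lemma doubleton_in_path_edges_iff:
  "{Suc i, Suc k} \<in> path_edges n \<longleftrightarrow> i < n \<and> k < n \<and> (k = Suc i \<or> i = Suc k)"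
proof
  assume "{Suc i, Suc k} \<in> path_edges n"
  then show "i < n \<and> k < n \<and> (k = Suc i \<or> i = Suc k)"
    by (auto simp: path_edges_def doubleton_eq_iff)
next
  assume *: "i < n \<and> k < n \<and> (k = Suc i \<or> i = Suc k)"
  then have "{Suc i, Suc k} = {min (Suc i) (Suc k), min (Suc i) (Suc k) + 1}" by auto
  moreover have "1 \<le> min (Suc i) (Suc k)" "min (Suc i) (Suc k) + 1 \<le> n" using * by auto
  ultimately show "{Suc i, Suc k} \<in> path_edges n" unfolding path_edges_def by blast
qed

lemma simple_graph_path: "simple_graph n (path_edges n)"
  unfolding simple_graph_def path_edges_def by fastforce

lemma laplacian_mat_carrier [simp]: "laplacian_mat n E \<in> carrier_mat n n"
  unfolding laplacian_mat_def adjacency_mat_def by (intro minus_carrier_mat mat_carrier)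

text \<open>Seen as a sum of differences over neighbours, the Laplacian needs no degree count: at an
  end of the path one difference is simply missing.\<close>

lemma laplacian_mult_vec_index:
  assumes v: "v \<in> carrier_vec n" and i: "i < n"
  shows "(laplacian_mat n E *\<^sub>v v) $ i = (\<Sum>k | k < n \<and> {Suc i, Suc k} \<in> E. v $ i - v $ k)"
proof -
  let ?N = "{k. k < n \<and> {Suc i, Suc k} \<in> E}"
  have "{u \<in> {1..n}. {Suc i, u} \<in> E} = Suc ` ?N"
    by (auto simp: image_iff) (metis Suc_le_D Suc_le_lessD)
  then have deg: "vertex_degree n E (Suc i) = card ?N"
    by (simp add: vertex_degree_def card_image)
  have "(laplacian_mat n E *\<^sub>v v) $ i =
      (\<Sum>k<n. (if i = k then of_nat (vertex_degree n E (Suc i)) * v $ k else 0) - (if {Suc i, Suc k} \<in> E then v $ k else 0))"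
    using v i by (simp add: laplacian_mat_def degree_mat_def adjacency_mat_def mat_diag_def
        scalar_prod_def atLeast0LessThan if_distrib[of "\<lambda>x. x * _"] left_diff_distrib cong: if_cong)
  also have "\<dots> = of_nat (card ?N) * v $ i - (\<Sum>k\<in>?N. v $ k)"
    using i unfolding deg by (simp add: sum_subtractf sum.inter_filter[symmetric])
  also have "\<dots> = (\<Sum>k\<in>?N. v $ i - v $ k)" by (simp add: sum_subtractf)
  finally show ?thesis .
qed

lemma laplacian_path_eigenvec:
  assumes "n > 0"
  shows "laplacian_mat n (path_edges n) *\<^sub>v path_eigenvec n j
    = of_real (2 - 2 * cos (pi * real j / real n)) \<cdot>\<^sub>v path_eigenvec n j"
proof (rule eq_vecI)
  fix i assume "i < dim_vec (of_real (2 - 2 * cos (pi * real j / real n)) \<cdot>\<^sub>v path_eigenvec n j)"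
  then have i: "i < n" by (simp add: path_eigenvec_def)
  define x where "x = pi * real j / real n"
  define u where "u = (\<lambda>k :: real. cos (x * (k + 1 / 2)))"
  have idx: "path_eigenvec n j $ k = of_real (u (real k))" if "k < n" for k
    using that by (simp add: path_eigenvec_index u_def x_def)
  \<comment> \<open>Fictitious vertices at positions -1 and \<open>n\<close> carry the same value as
    the adjacent end vertices, so the missing differences can be added as zeros.\<close>
  have bd0: "u (- 1) = u 0" by (simp add: u_def)
  have bdn: "u (real n) = u (real n - 1)"
  proof -
    have xn: "x * (real n + 1 / 2) = 2 * pi * real j - x * (real n - 1 + 1 / 2)"
      using assms by (simp add: x_def field_simps)
    have "sin (2 * pi * real j) = 0" "cos (2 * pi * real j) = 1"
      using sin_2npi[of j] cos_2npi[of j] by (simp_all add: mult_ac)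
    then show ?thesis unfolding u_def xn cos_diff by simp
  qed
  have nbrs: "{k. k < n \<and> {Suc i, Suc k} \<in> path_edges n}
      = (if i = 0 then {} else {i - 1}) \<union> (if Suc i = n then {} else {Suc i})"
    using i by (auto simp: doubleton_in_path_edges_iff)
  have "(laplacian_mat n (path_edges n) *\<^sub>v path_eigenvec n j) $ i
      = (\<Sum>k | k < n \<and> {Suc i, Suc k} \<in> path_edges n. path_eigenvec n j $ i - path_eigenvec n j $ k)"
    by (rule laplacian_mult_vec_index) (simp_all add: i)
  also have "\<dots> = (\<Sum>k | k < n \<and> {Suc i, Suc k} \<in> path_edges n. of_real (u (real i) - u (real k)))"
    using i by (intro sum.cong) (auto simp: idx)
  also have "\<dots> = of_real ((u (real i) - u (real i - 1)) + (u (real i) - u (real i + 1)))"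
  proof -
    have "(\<Sum>k\<in>(if i = 0 then {} else {i - 1}). complex_of_real (u (real i) - u (real k)))
        = of_real (u (real i) - u (real i - 1))"
      using bd0 by (auto simp: of_nat_diff)
    moreover have "(\<Sum>k\<in>(if Suc i = n then {} else {Suc i}). complex_of_real (u (real i) - u (real k)))
        = of_real (u (real i) - u (real i + 1))"
      using bdn by (auto simp: add.commute)
    ultimately show ?thesis
      unfolding nbrs by (subst sum.union_disjoint) auto
  qed
  also have "(u (real i) - u (real i - 1)) + (u (real i) - u (real i + 1)) = (2 - 2 * cos x) * u (real i)"
  proof -
    define y where "y = x * (real i + 1 / 2)"
    have y: "x * (real i - 1 + 1 / 2) = y - x" "x * (real i + 1 + 1 / 2) = y + x"
      by (simp_all add: y_def algebra_simps)
    show ?thesis unfolding u_def y y_def[symmetric] cos_diff cos_add by (simp add: algebra_simps)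
  qed
  finally show "(laplacian_mat n (path_edges n) *\<^sub>v path_eigenvec n j) $ i
      = (of_real (2 - 2 * cos (pi * real j / real n)) \<cdot>\<^sub>v path_eigenvec n j) $ i"
    using i by (simp add: idx x_def) (simp add: path_eigenvec_def idx[symmetric] x_def u_def)
qed (simp add: laplacian_mat_def degree_mat_def adjacency_mat_def path_eigenvec_def)

lemma transition_mat_path_eigenvec:
  assumes "n > 0"
  shows "transition_mat n (path_edges n) t *\<^sub>v path_eigenvec n j
    = exp (- \<i> * of_real (t * (2 - 2 * cos (pi * real j / real n)))) \<cdot>\<^sub>v path_eigenvec n j"
  unfolding transition_mat_def
proof (rule mat_exp_mult_eigenvector[where n = n])
  show C: "(- \<i> * of_real t) \<cdot>\<^sub>m laplacian_mat n (path_edges n) \<in> carrier_mat n n"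
    by (intro smult_carrier_mat laplacian_mat_carrier)
  have "((- \<i> * of_real t) \<cdot>\<^sub>m laplacian_mat n (path_edges n)) *\<^sub>v path_eigenvec n j
      = (- \<i> * of_real t) \<cdot>\<^sub>v (laplacian_mat n (path_edges n) *\<^sub>v path_eigenvec n j)"
    by (intro eq_vecI) (simp_all add: carrier_matD[OF laplacian_mat_carrier] scalar_prod_def
        path_eigenvec_def sum_distrib_left sum_negf mult_ac)
  then show "((- \<i> * of_real t) \<cdot>\<^sub>m laplacian_mat n (path_edges n)) *\<^sub>v path_eigenvec n j
      = (- \<i> * of_real (t * (2 - 2 * cos (pi * real j / real n)))) \<cdot>\<^sub>v path_eigenvec n j"
    by (simp add: laplacian_path_eigenvec[OF assms] smult_smult_assoc mult_ac)
qed simp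

section \<open>Orthogonality and symmetry of the eigenvectors\<close>

lemma sum_cos_multiple:
  assumes n: "n > 0" and m: "\<bar>m\<bar> < 2 * int n"
  shows "(\<Sum>j<2 * n. cos (pi * real j * of_int m / real n)) = (if m = 0 then 2 * real n else 0)"
proof (cases "m = 0")
  case False
  define w where "w = cis (pi * of_int m / real n)"
  \<comment> \<open>The bound on \<open>m\<close> excludes nonzero multiples of
    \<open>2 * n\<close>, so the geometric sum over the \<open>2 * n\<close>-th root of unity
    \<open>w\<close> vanishes.\<close>
  have "w \<noteq> 1"
  proof
    assume "w = 1"
    then obtain k :: int where "pi * of_int m / real n = 2 * pi * of_int k"
      by (auto simp: w_def cis_conv_exp exp_eq_1)
    then have "pi * of_int m = pi * of_int (2 * int n * k)"
      using n by (simp add: field_simps)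
    then have "m = 2 * int n * k" unfolding mult_cancel_left of_int_eq_iff by simp
    then show False using m False by (metis abs_mult abs_of_nat dvd_imp_le_int dvd_triv_left not_less abs_mult_pos abs_numeral)
  qed
  have "real (2 * n) * (pi * of_int m / real n) = 2 * pi * of_int m" using n by simp
  then have "w ^ (2 * n) = cis (2 * pi * of_int m)" by (simp only: w_def Complex.DeMoivre)
  also have "\<dots> = 1" by (rule cis_multiple_2pi) simp
  finally have "(\<Sum>j<2 * n. w ^ j) = 0" using geometric_sum[OF \<open>w \<noteq> 1\<close>] by simp
  then have "0 = Re (\<Sum>j<2 * n. w ^ j)" by simp
  also have "\<dots> = (\<Sum>j<2 * n. cos (pi * real j * of_int m / real n))"
    by (simp add: w_def Complex.DeMoivre mult_ac)
  finally show ?thesis using False by simp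
qed simp

text \<open>Summing over a full period of \<open>2 * n\<close> indices turns all sums into geometric ones over roots
  of unity. Every eigenvector with \<open>0 < j < n\<close> occurs twice, and the one with \<open>j = n\<close> vanishes.\<close>

lemma sum_path_eigenvec_orthogonal:
  assumes "i < n" "k < n"
  shows "(\<Sum>j<2 * n. path_eigenvec n j $ i * path_eigenvec n j $ k) = (if i = k then of_nat n else 0)"
proof -
  have n: "n > 0" using assms by simp
  have prod: "cos (pi * real j * (real i + 1 / 2) / real n) * cos (pi * real j * (real k + 1 / 2) / real n)
    = (cos (pi * real j * of_int (int i - int k) / real n) + cos (pi * real j * of_int (int i + int k + 1) / real n)) / 2" for j
  proof -
    have "pi * real j * (real i + 1 / 2) / real n - pi * real j * (real k + 1 / 2) / real n
        = pi * real j * of_int (int i - int k) / real n"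
      "pi * real j * (real i + 1 / 2) / real n + pi * real j * (real k + 1 / 2) / real n
        = pi * real j * of_int (int i + int k + 1) / real n"
      using n by (simp_all add: field_simps)
    then show ?thesis unfolding cos_times_cos by simp
  qed
  have "(\<Sum>j<2 * n. path_eigenvec n j $ i * path_eigenvec n j $ k)
    = of_real (\<Sum>j<2 * n. cos (pi * real j * (real i + 1 / 2) / real n) * cos (pi * real j * (real k + 1 / 2) / real n))"
    using assms by (simp add: path_eigenvec_index)
  also have "(\<Sum>j<2 * n. cos (pi * real j * (real i + 1 / 2) / real n) * cos (pi * real j * (real k + 1 / 2) / real n))
    = ((\<Sum>j<2 * n. cos (pi * real j * of_int (int i - int k) / real n))
        + (\<Sum>j<2 * n. cos (pi * real j * of_int (int i + int k + 1) / real n))) / 2"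
    unfolding prod sum_divide_distrib[symmetric] sum.distrib ..
  also have "\<dots> = (if i = k then real n else 0)"
  proof -
    \<comment> \<open>The two offsets \<open>1/2\<close> add up to 1, so the sum frequency lies
      strictly between 0 and \<open>2 * n\<close> and never contributes.\<close>
    have "\<bar>int i - int k\<bar> < 2 * int n" "\<bar>int i + int k + 1\<bar> < 2 * int n" "int i + int k + 1 \<noteq> 0"
      using assms by auto
    then show ?thesis by (simp only: sum_cos_multiple[OF n]) simp
  qed
  finally show ?thesis by simp
qed

lemma path_eigenvec_norm_le: "k < n \<Longrightarrow> cmod (path_eigenvec n j $ k) \<le> 1"
  by (simp add: path_eigenvec_index)

lemma path_eigenvec_0: "k < n \<Longrightarrow> path_eigenvec n 0 $ k = 1"
  by (simp add: path_eigenvec_index)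

lemma path_eigenvec_n:
  assumes "k < n"
  shows "path_eigenvec n n $ k = 0"
proof -
  have eq: "pi * real n * (real k + 1 / 2) / real n = pi * real k + pi / 2"
    using assms by (simp add: field_simps)
  show ?thesis using assms unfolding path_eigenvec_index[OF assms] eq cos_add by simp
qed

text \<open>Reflection takes \<open>k + 1/2\<close> to \<open>n - (k + 1/2)\<close>, hence the angle
  to \<open>pi * j\<close> minus the angle.\<close>

lemma path_eigenvec_reflect:
  assumes "k < n"
  shows "path_eigenvec n j $ (n - 1 - k) = (- 1) ^ j * path_eigenvec n j $ k"
proof -
  have eq: "pi * real j * (real (n - 1 - k) + 1 / 2) / real n
      = pi * real j - pi * real j * (real k + 1 / 2) / real n"
    using assms by (simp add: of_nat_diff field_simps)
  have lt: "n - 1 - k < n" using assms by simp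
  have "cos (pi * real j) = (- 1) ^ j" "sin (pi * real j) = 0"
    using cos_npi[of j] sin_npi[of j] by (simp_all add: mult.commute)
  then show ?thesis
    unfolding path_eigenvec_index[OF assms] path_eigenvec_index[OF lt] eq cos_diff by simp
qed

lemma unit_vec_diff_expansion:
  assumes "i < n" "i' < n" "k < n"
  shows "(unit_vec n i - unit_vec n i') $ k
    = (\<Sum>j<2 * n. (path_eigenvec n j $ i - path_eigenvec n j $ i') / of_nat n * path_eigenvec n j $ k)"
proof -
  have "(\<Sum>j<2 * n. (path_eigenvec n j $ i - path_eigenvec n j $ i') / of_nat n * path_eigenvec n j $ k)
      = ((\<Sum>j<2 * n. path_eigenvec n j $ i * path_eigenvec n j $ k)
          - (\<Sum>j<2 * n. path_eigenvec n j $ i' * path_eigenvec n j $ k)) / of_nat n"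
    by (simp add: sum_subtractf[symmetric] sum_divide_distrib left_diff_distrib)
  then show ?thesis using assms by (simp add: sum_path_eigenvec_orthogonal)
qed

text \<open>Only linearity enters, so the expansion may run over a redundant family such as the
  \<open>2 * n\<close> eigenvectors of the path.\<close>

lemma mult_mat_vec_eigen_expansion:
  fixes M :: "'a :: comm_ring_1 mat"
  assumes M: "M \<in> carrier_mat n n" and x: "x \<in> carrier_vec n"
    and v: "\<And>j. j \<in> J \<Longrightarrow> v j \<in> carrier_vec n"
    and eig: "\<And>j. j \<in> J \<Longrightarrow> M *\<^sub>v v j = e j \<cdot>\<^sub>v v j"
    and exp: "\<And>k. k < n \<Longrightarrow> x $ k = (\<Sum>j\<in>J. c j * v j $ k)"
    and l: "l < n"
  shows "(M *\<^sub>v x) $ l = (\<Sum>j\<in>J. c j * e j * v j $ l)"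
proof -
  have "(M *\<^sub>v x) $ l = (\<Sum>k<n. \<Sum>j\<in>J. c j * (M $$ (l, k) * v j $ k))"
    using M x l by (simp add: scalar_prod_def atLeast0LessThan exp sum_distrib_left mult_ac)
  also have "\<dots> = (\<Sum>j\<in>J. c j * (\<Sum>k<n. M $$ (l, k) * v j $ k))"
    by (subst sum.swap) (simp add: sum_distrib_left)
  also have "\<dots> = (\<Sum>j\<in>J. c j * (M *\<^sub>v v j) $ l)"
    using M l by (intro sum.cong refl) (simp add: scalar_prod_def atLeast0LessThan carrier_vecD[OF v])
  also have "\<dots> = (\<Sum>j\<in>J. c j * e j * v j $ l)"
    using l by (intro sum.cong refl) (simp add: eig carrier_vecD[OF v] mult_ac)
  finally show ?thesis .
qed

section \<open>From approximate phases to edge transfer\<close>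

lemma l2_norm_vec_le:
  assumes "v \<in> carrier_vec n" and "\<And>k. k < n \<Longrightarrow> cmod (v $ k) \<le> B"
  shows "l2_norm_vec v \<le> real n * B"
proof -
  have "l2_norm_vec v \<le> (\<Sum>k = 0..<n. cmod (v $ k))"
    using assms(1) unfolding l2_norm_vec_def by (simp add: L2_set_le_sum)
  also have "\<dots> \<le> (\<Sum>k = 0..<n. B)" using assms(2) by (intro sum_mono) auto
  finally show ?thesis by simp
qed

text \<open>Both vectors are expanded in the eigenvectors and compared termwise. Each of the
  \<open>2 * n\<close> terms is off by at most \<open>2 * \<delta> / n\<close>, so each of the
  \<open>n\<close> entries is off by at most \<open>4 * \<delta>\<close>.\<close>

lemma path_edge_transfer_approx:
  fixes g :: complex
  assumes a: "Suc a < n" and "0 \<le> \<delta>"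
    and approx: "\<And>j. 0 < j \<Longrightarrow> j < n \<Longrightarrow>
      cmod (exp (\<i> * of_real (2 * t * cos (pi * real j / real n))) - g * (- 1) ^ j) \<le> \<delta>"
  shows "l2_norm_vec (transition_mat n (path_edges n) t *\<^sub>v (unit_vec n a - unit_vec n (Suc a))
      - (- exp (- \<i> * of_real (2 * t)) * g) \<cdot>\<^sub>v (unit_vec n (n - 1 - Suc a) - unit_vec n (n - 1 - a)))
    \<le> 4 * real n * \<delta>"
proof -
  define v where "v = path_eigenvec n"
  define U where "U = transition_mat n (path_edges n) t"
  \<comment> \<open>The constant 2 in every eigenvalue contributes this common phase.\<close>
  define w where "w = exp (- \<i> * of_real (2 * t))"
  define x where "x = unit_vec n a - (unit_vec n (Suc a) :: complex Matrix.vec)"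
  \<comment> \<open>The reflection of \<open>x\<close> is \<open>-y\<close>, since it reverses the
    orientation of the edge; hence the minus sign in the final phase.\<close>
  define y where "y = unit_vec n (n - 1 - Suc a) - (unit_vec n (n - 1 - a) :: complex Matrix.vec)"
  define c where "c = (\<lambda>j. (v j $ a - v j $ Suc a) / of_nat n)"
  define e where "e = (\<lambda>j. exp (\<i> * of_real (2 * t * cos (pi * real j / real n))))"
  have n: "n > 0" using a by simp
  have U: "U \<in> carrier_mat n n"
    by (simp add: U_def transition_mat_def mat_exp_def carrier_matD[OF laplacian_mat_carrier])
  have x: "x $ k = (\<Sum>j<2 * n. c j * v j $ k)" if "k < n" for k
    unfolding x_def c_def v_def using a that by (intro unit_vec_diff_expansion) auto
  have y: "y $ k = (\<Sum>j<2 * n. - ((- 1) ^ j) * c j * v j $ k)" if "k < n" for k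
  proof -
    have "y $ k = (\<Sum>j<2 * n. (v j $ (n - 1 - Suc a) - v j $ (n - 1 - a)) / of_nat n * v j $ k)"
      unfolding y_def v_def using a that by (intro unit_vec_diff_expansion) auto
    also have "\<dots> = (\<Sum>j<2 * n. - ((- 1) ^ j) * c j * v j $ k)"
    proof (intro sum.cong refl)
      fix j
      have "v j $ (n - 1 - Suc a) - v j $ (n - 1 - a) = (- 1) ^ j * v j $ Suc a - (- 1) ^ j * v j $ a"
        using a by (simp only: v_def path_eigenvec_reflect)
      also have "\<dots> = - ((- 1) ^ j) * (v j $ a - v j $ Suc a)" by (simp add: algebra_simps)
      finally have "v j $ (n - 1 - Suc a) - v j $ (n - 1 - a) = \<dots>" .
      then show "(v j $ (n - 1 - Suc a) - v j $ (n - 1 - a)) / of_nat n * v j $ k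
          = - ((- 1) ^ j) * c j * v j $ k"
        by (simp only: c_def times_divide_eq_right)
    qed
    finally show ?thesis .
  qed
  have Uv: "U *\<^sub>v v j = (w * e j) \<cdot>\<^sub>v v j" for j
  proof -
    have "exp (- \<i> * of_real (t * (2 - 2 * cos (pi * real j / real n)))) = w * e j"
      unfolding w_def e_def exp_add[symmetric] by (simp add: algebra_simps)
    then show ?thesis unfolding U_def v_def transition_mat_path_eigenvec[OF n] by simp
  qed
  have "cmod w = 1" by (simp add: w_def)
  have e_approx: "cmod (e j - g * (- 1) ^ j) \<le> \<delta>" if "0 < j" "j < 2 * n" "j \<noteq> n" for j
  proof (cases "j < n")
    case True
    then show ?thesis using approx that by (simp add: e_def)
  next
    case False
    \<comment> \<open>Indices above \<open>n\<close> fold back to \<open>2 * n - j\<close>, which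
      has the same cosine and the same parity.\<close>
    then have j: "0 < 2 * n - j" "2 * n - j < n" using that by auto
    have "pi * real (2 * n - j) / real n = 2 * pi - pi * real j / real n"
      using n that by (simp add: of_nat_diff field_simps)
    then have "cos (pi * real (2 * n - j) / real n) = cos (pi * real j / real n)"
      by (simp only: cos_diff cos_two_pi sin_two_pi)
    moreover have "(- 1 :: complex) ^ (2 * n - j) = (- 1) ^ j"
      using that by (simp add: minus_one_power_iff)
    ultimately show ?thesis using approx[OF j] by (simp only: e_def)
  qed
  have term_le: "cmod (c j * w * (e j - g * (- 1) ^ j) * v j $ k) \<le> 2 / real n * \<delta>"
    if "j < 2 * n" "k < n" for j k
  proof (cases "j = 0 \<or> j = n")
    \<comment> \<open>The two indices on which \<open>approx\<close> gives no information have
      coefficient 0: the eigenvector is constant for \<open>j = 0\<close> and zero for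
      \<open>j = n\<close>.\<close>
    case True
    then have "c j = 0" using a by (auto simp: c_def v_def path_eigenvec_0 path_eigenvec_n)
    then show ?thesis using \<open>0 \<le> \<delta>\<close> by simp
  next
    case False
    have "cmod (v j $ a - v j $ Suc a) \<le> cmod (v j $ a) + cmod (v j $ Suc a)"
      by (rule norm_triangle_ineq4)
    also have "\<dots> \<le> 1 + 1" unfolding v_def using a by (intro add_mono path_eigenvec_norm_le) auto
    finally have "cmod (c j) \<le> 2 / real n"
      using n by (simp add: c_def norm_divide divide_right_mono)
    moreover have "cmod (e j - g * (- 1) ^ j) \<le> \<delta>" using False that by (intro e_approx) auto
    moreover have "cmod (v j $ k) \<le> 1" unfolding v_def using that by (intro path_eigenvec_norm_le)
    ultimately have "cmod (c j) * cmod (e j - g * (- 1) ^ j) * cmod (v j $ k) \<le> 2 / real n * \<delta> * 1"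
      using \<open>0 \<le> \<delta>\<close> by (intro mult_mono) auto
    then show ?thesis using \<open>cmod w = 1\<close> by (simp add: norm_mult)
  qed
  have "l2_norm_vec (U *\<^sub>v x - (- w * g) \<cdot>\<^sub>v y) \<le> real n * (4 * \<delta>)"
  proof (rule l2_norm_vec_le)
    show "U *\<^sub>v x - (- w * g) \<cdot>\<^sub>v y \<in> carrier_vec n"
      by (rule carrier_vecI) (simp add: y_def)
    fix k assume k: "k < n"
    have "(U *\<^sub>v x) $ k = (\<Sum>j<2 * n. c j * (w * e j) * v j $ k)"
    proof (rule mult_mat_vec_eigen_expansion[OF U _ _ Uv _ k])
      show "x \<in> carrier_vec n" by (simp add: x_def)
      show "v j \<in> carrier_vec n" for j by (simp add: v_def)
    qed (rule x)
    moreover have "((- w * g) \<cdot>\<^sub>v y) $ k = (\<Sum>j<2 * n. c j * (w * (g * (- 1) ^ j)) * v j $ k)"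
    proof -
      have "((- w * g) \<cdot>\<^sub>v y) $ k = (- w * g) * y $ k" using k by (simp add: y_def)
      also have "\<dots> = (\<Sum>j<2 * n. (- w * g) * (- ((- 1) ^ j) * c j * v j $ k))"
        unfolding y[OF k] sum_distrib_left ..
      also have "\<dots> = (\<Sum>j<2 * n. c j * (w * (g * (- 1) ^ j)) * v j $ k)"
        by (intro sum.cong refl) (simp add: mult_ac)
      finally show ?thesis .
    qed
    moreover have "(U *\<^sub>v x - (- w * g) \<cdot>\<^sub>v y) $ k = (U *\<^sub>v x) $ k - ((- w * g) \<cdot>\<^sub>v y) $ k"
      using k by (simp add: y_def)
    ultimately have "(U *\<^sub>v x - (- w * g) \<cdot>\<^sub>v y) $ k
        = (\<Sum>j<2 * n. c j * (w * e j) * v j $ k - c j * (w * (g * (- 1) ^ j)) * v j $ k)"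
      by (simp only: sum_subtractf)
    also have "\<dots> = (\<Sum>j<2 * n. c j * w * (e j - g * (- 1) ^ j) * v j $ k)"
      by (intro sum.cong refl) (simp only: right_diff_distrib left_diff_distrib mult.assoc)
    also have "cmod \<dots> \<le> (\<Sum>j<2 * n. 2 / real n * \<delta>)"
      using k by (intro order_trans[OF norm_sum] sum_mono term_le) auto
    also have "\<dots> = 4 * \<delta>" using n by simp
    finally show "cmod ((U *\<^sub>v x - (- w * g) \<cdot>\<^sub>v y) $ k) \<le> 4 * \<delta>" .
  qed
  then show ?thesis by (simp add: U_def x_def y_def w_def mult_ac)
qed

theorem theorem3p3:
  fixes n a :: nat
  assumes "n \<ge> 2"
    and "(\<exists>k. n = 2 ^ k) \<or> (prime n \<and> odd n)"
    and "1 \<le> a" and "a \<le> n - 1"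
  shows "edge_LPGST n (path_edges n) a (a + 1) (n - a) (n - a + 1)"
  unfolding edge_LPGST_def
proof (intro conjI allI impI)
  show "simple_graph n (path_edges n)" by (rule simple_graph_path)
  show "{a, a + 1} \<in> path_edges n" "{n - a, n - a + 1} \<in> path_edges n"
    using assms unfolding path_edges_def by auto
  fix \<epsilon> :: real assume "\<epsilon> > 0"
  \<comment> \<open>With this choice the error bound \<open>4 * n * \<delta>\<close> equals
    \<open>\<epsilon> / 2\<close>.\<close>
  define \<delta> where "\<delta> = \<epsilon> / (8 * real n)"
  have "\<delta> > 0" using \<open>\<epsilon> > 0\<close> assms(1) by (simp add: \<delta>_def)
  then obtain s g where g: "cmod g = 1" and s: "\<And>j. 0 < j \<Longrightarrow> j < n \<Longrightarrow>
      cmod (exp (\<i> * of_real (s * cos (pi * real j / real n))) - g * (- 1) ^ j) < \<delta>"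
    using exp_cos_approx_alternating[OF assms(1,2)] by blast
  obtain b where b: "a = Suc b" using assms(3) by (cases a) auto
  \<comment> \<open>The time is halved because the eigenvalues contain twice the cosine;
    \<open>b\<close> is the zero-based index of vertex \<open>a\<close>.\<close>
  have "l2_norm_vec (transition_mat n (path_edges n) (s / 2) *\<^sub>v (unit_vec n b - unit_vec n (Suc b))
      - (- exp (- \<i> * of_real (2 * (s / 2))) * g) \<cdot>\<^sub>v (unit_vec n (n - 1 - Suc b) - unit_vec n (n - 1 - b)))
    \<le> 4 * real n * \<delta>"
    using assms(1,4) \<open>\<delta> > 0\<close> s by (intro path_edge_transfer_approx) (auto simp: b less_imp_le)
  also have "\<dots> < \<epsilon>" using \<open>\<epsilon> > 0\<close> assms(1) by (simp add: \<delta>_def)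
  finally show "\<exists>\<tau> g. cmod g = 1 \<and>
      l2_norm_vec (transition_mat n (path_edges n) \<tau> *\<^sub>v (vertex_vec n a - vertex_vec n (a + 1))
        - g \<cdot>\<^sub>v (vertex_vec n (n - a) - vertex_vec n (n - a + 1))) < \<epsilon>"
    using g b
    by (intro exI[of _ "s / 2"] exI[of _ "- exp (- \<i> * of_real (2 * (s / 2))) * g"])
      (simp add: vertex_vec_def norm_mult)
qed

end
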